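(* Let $0<a<b<c<d<f<e$ be real numbers such that both matrices $$S_1=\begin{pmatrix} 0 & a & b & d \\ a & 0 & c & e \\ b & c & 0 & f \\ d & e & f & 0 \end{pmatrix},\qquad S_2=\begin{pmatrix} 0 & a & b & f \\ a & 0 & c & e \\ b & c & 0 & d \\ f & e & d & 0 \end{pmatrix}$$ satisfy the triangle inequalities, and let $X_i$ be the four-point metric space with distance matrix $S_i$, $i=1,2$. Then, for $i=1,2$ and all $t>0$, $m\in\mathbb{N}$, the distance $d_{GH}(t\Delta_m,X_i)$ does not depend on $f$ (i.e. for fixed $a,b,c,d,e$ it takes the same value for all $f$ with $d<f<e$ such that both matrices $S_1$ and $S_2$ satisfy the triangle inequalities). Consequently, there exists an infinite family, of cardinality continuum, of pairwise non-isometric finite metric spaces such that for any two members $Y,Y'$ of the family one has $d_{GH}(t\Delta_m,Y)=d_{GH}(t\Delta_m,Y')$ for all $t>0$ and $m\in\mathbb{N}$.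
   Context: $\mathbb{N}=\{1,2,\ldots\}$ and $d_{GH}$ is the Gromov--Hausdorff distance. $t\Delta_m$ denotes the $m$-point metric space (simplex) all of whose nonzero distances equal $t$. A space $\{x_1,x_2,x_3,x_4\}$ with distance matrix $S=(s_{ij})$ has $|x_ix_j|=s_{ij}$. *)

theory Defs
  imports "HOL-Analysis.Analysis" "HOL-Library.Equipollence"
begin

definition isometric :: "'a metric \<Rightarrow> 'b metric \<Rightarrow> bool" where
  "isometric X Y \<longleftrightarrow> (\<exists>h. bij_betw h (mspace X) (mspace Y) \<and>
     (\<forall>x\<in>mspace X. \<forall>y\<in>mspace X. mdist Y (h x) (h y) = mdist X x y))"

text \<open>Hausdorff distance of two subsets of (the carrier of) a metric space, with values in
  \<open>[0, \<infinity>]\<close> so that unbounded sets need no special treatment.\<close>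

definition hausdorff_dist :: "'a metric \<Rightarrow> 'a set \<Rightarrow> 'a set \<Rightarrow> ennreal" where
  "hausdorff_dist Z A B =
     max (SUP x\<in>A. INF y\<in>B. ennreal (mdist Z x y)) (SUP y\<in>B. INF x\<in>A. ennreal (mdist Z x y))"

text \<open>Infimum over all realizations \<open>(A, B, Z)\<close>: a metric space \<open>Z\<close> with subsets \<open>A\<close>, \<open>B\<close>
  isometric to \<open>X\<close>, \<open>Y\<close>. HOL cannot quantify over the type of \<open>Z\<close>, but \<open>'a + 'b\<close> loses
  nothing: the Hausdorff distance only depends on the subspace \<open>A \<union> B\<close> of \<open>Z\<close>, which
  injects into the disjoint union of \<open>X\<close> and \<open>Y\<close>.\<close>

definition gh_dist :: "'a metric \<Rightarrow> 'b metric \<Rightarrow> ennreal" where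
  "gh_dist X Y = Inf {hausdorff_dist Z A B | (Z :: ('a + 'b) metric) A B.
     A \<subseteq> mspace Z \<and> B \<subseteq> mspace Z \<and>
     isometric (submetric Z A) X \<and> isometric (submetric Z B) Y}"

text \<open>The simplex \<open>t\<Delta>\<^sub>m\<close>; meaningful for \<open>t > 0\<close>.\<close>

definition simplex_metric :: "real \<Rightarrow> nat \<Rightarrow> nat metric" where
  "simplex_metric t m = metric ({1..m}, \<lambda>i j. if i = j then 0 else t)"

lemma simplex_metric:
  assumes "t > 0"
  shows "mspace (simplex_metric t m) = {1..m}"
    and "mdist (simplex_metric t m) = (\<lambda>i j. if i = j then 0 else t)"
proof -
  interpret Metric_space "{1..m}" "\<lambda>i j. if i = j then 0 else t"
    using assms by unfold_locales auto
  show "mspace (simplex_metric t m) = {1..m}"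
    and "mdist (simplex_metric t m) = (\<lambda>i j. if i = j then 0 else t)"
    unfolding simplex_metric_def by (rule mspace_metric, rule mdist_metric)
qed

definition triangle_inequalities :: "real^'n^'n \<Rightarrow> bool" where
  "triangle_inequalities S \<longleftrightarrow> (\<forall>i j k. S $ i $ k \<le> S $ i $ j + S $ j $ k)"

text \<open>The finite metric space with distance matrix \<open>S\<close>; as with \<^const>\<open>metric\<close> itself, the
  value is unspecified if \<open>S\<close> is not a distance matrix.\<close>

definition matrix_metric :: "real^'n^'n \<Rightarrow> 'n metric" where
  "matrix_metric S = metric (UNIV, \<lambda>i j. S $ i $ j)"

lemma matrix_metric:
  fixes S :: "real^'n^'n"
  assumes "triangle_inequalities S" "transpose S = S"
    and "\<And>i. S $ i $ i = 0" "\<And>i j. i \<noteq> j \<Longrightarrow> 0 < S $ i $ j"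
  shows "mspace (matrix_metric S) = UNIV" and "mdist (matrix_metric S) = (\<lambda>i j. S $ i $ j)"
proof -
  interpret Metric_space "UNIV :: 'n set" "\<lambda>i j. S $ i $ j"
  proof
    show "0 \<le> S $ i $ j" for i j
      using assms(3,4) by (cases "i = j") (auto simp: less_imp_le)
    show "S $ i $ j = S $ j $ i" for i j
      using assms(2) by (metis transpose_def vec_lambda_beta)
    show "S $ i $ j = 0 \<longleftrightarrow> i = j" for i j
      using assms(3) assms(4)[of i j] by (cases "i = j") auto
    show "S $ i $ k \<le> S $ i $ j + S $ j $ k" for i j k
      using assms(1) by (simp add: triangle_inequalities_def)
  qed
  show "mspace (matrix_metric S) = UNIV" and "mdist (matrix_metric S) = (\<lambda>i j. S $ i $ j)"
    by (simp_all add: matrix_metric_def)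
qed

definition S1 :: "real \<Rightarrow> real \<Rightarrow> real \<Rightarrow> real \<Rightarrow> real \<Rightarrow> real \<Rightarrow> real^4^4" where
  "S1 a b c d e f = vector [vector [0, a, b, d],
                            vector [a, 0, c, e],
                            vector [b, c, 0, f],
                            vector [d, e, f, 0]]"

definition S2 :: "real \<Rightarrow> real \<Rightarrow> real \<Rightarrow> real \<Rightarrow> real \<Rightarrow> real \<Rightarrow> real^4^4" where
  "S2 a b c d e f = vector [vector [0, a, b, f],
                            vector [a, 0, c, e],
                            vector [b, c, 0, d],
                            vector [f, e, d, 0]]"

lemma vector_4:
  fixes x y z w :: "'a::zero"
  shows "(vector [x,y,z,w] :: 'a^4) $ 1 = x" "(vector [x,y,z,w] :: 'a^4) $ 2 = y"
    "(vector [x,y,z,w] :: 'a^4) $ 3 = z" "(vector [x,y,z,w] :: 'a^4) $ 4 = w"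
  by (simp_all add: vector_def)

lemma S1_matrix_metric:
  assumes "0 < a" "a < b" "b < c" "c < d" "d < f" "f < e"
    and "triangle_inequalities (S1 a b c d e f)"
  shows "mspace (matrix_metric (S1 a b c d e f)) = UNIV"
    and "mdist (matrix_metric (S1 a b c d e f)) = (\<lambda>i j. S1 a b c d e f $ i $ j)"
proof -
  have *: "transpose (S1 a b c d e f) = S1 a b c d e f"
    by (simp add: vec_eq_iff transpose_def forall_4 S1_def vector_4)
  have **: "\<forall>i. S1 a b c d e f $ i $ i = 0"
    by (simp add: forall_4 S1_def vector_4)
  have ***: "\<forall>i j. i \<noteq> j \<longrightarrow> 0 < S1 a b c d e f $ i $ j"
    using assms(1-6) by (simp add: forall_4 S1_def vector_4)
  show "mspace (matrix_metric (S1 a b c d e f)) = UNIV"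
    and "mdist (matrix_metric (S1 a b c d e f)) = (\<lambda>i j. S1 a b c d e f $ i $ j)"
    using matrix_metric[OF assms(7) *] ** *** by blast+
qed

lemma S2_matrix_metric:
  assumes "0 < a" "a < b" "b < c" "c < d" "d < f" "f < e"
    and "triangle_inequalities (S2 a b c d e f)"
  shows "mspace (matrix_metric (S2 a b c d e f)) = UNIV"
    and "mdist (matrix_metric (S2 a b c d e f)) = (\<lambda>i j. S2 a b c d e f $ i $ j)"
proof -
  have *: "transpose (S2 a b c d e f) = S2 a b c d e f"
    by (simp add: vec_eq_iff transpose_def forall_4 S2_def vector_4)
  have **: "\<forall>i. S2 a b c d e f $ i $ i = 0"
    by (simp add: forall_4 S2_def vector_4)
  have ***: "\<forall>i j. i \<noteq> j \<longrightarrow> 0 < S2 a b c d e f $ i $ j"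
    using assms(1-6) by (simp add: forall_4 S2_def vector_4)
  show "mspace (matrix_metric (S2 a b c d e f)) = UNIV"
    and "mdist (matrix_metric (S2 a b c d e f)) = (\<lambda>i j. S2 a b c d e f $ i $ j)"
    using matrix_metric[OF assms(7) *] ** *** by blast+
qed

end

theory Submission
  imports Defs
begin

text \<open>
  The Gromov--Hausdorff distance is half the infimal distortion of a correspondence
  (\<open>correspondence_if_gh_dist_less\<close>, \<open>gh_dist_le_correspondence\<close>). For the
  simplex \<open>t\<Delta>\<^sub>m\<close> the distortion of a correspondence \<open>R\<close> with \<open>Y\<close> is governed by two sets of
  distances of \<open>Y\<close>: those between points sharing a partner in \<open>R\<close>, which bound the distortion
  from below as they stand, and those between points having distinct partners, which contribute
  their difference to \<open>t\<close>.

  For a four-point space in which \<open>a < b < c\<close> are the sides of a triangle, the longest edge at the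
  fourth point is \<open>e\<close>, and the shortest is \<open>d > c\<close>, this leads to an explicit value
  (lemma \<open>gh_dist_simplex_four_points\<close>). An optimal correspondence merges the points of the
  triangle in the order of single linkage: \<open>{1,2,3,4}\<close>, \<open>{1,2,3} {4}\<close>, \<open>{1,2} {3} {4}\<close>, all points
  separate; for \<open>m > 4\<close> one of these has several partners, which costs \<open>t\<close>.
  Only the largest diameter of a block, the smallest distance between two blocks and the
  largest distance between two blocks matter. For \<open>m > 1\<close> no edge at the fourth point lies inside a block, so these edges enter only through their minimum \<open>d\<close> and their maximum
  \<open>e\<close>; for \<open>m = 1\<close> only the diameter \<open>e\<close> counts. The third edge \<open>f\<close> at the fourth point, lying
  between \<open>d\<close> and \<open>e\<close>, is therefore invisible, whichever of the two remaining vertices of the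
  triangle it ends in.

  The continuum of spaces arises from letting \<open>f\<close> run through an interval: \<open>f\<close> can be
  recovered from the set of distances, so different values give non-isometric spaces.
\<close>

section \<open>Correspondences and the Gromov--Hausdorff distance\<close>

definition correspondence :: "('a \<times> 'b) set \<Rightarrow> 'a metric \<Rightarrow> 'b metric \<Rightarrow> bool" where
  "correspondence R X Y \<longleftrightarrow> fst ` R = mspace X \<and> snd ` R = mspace Y"

definition distortion_le :: "('a \<times> 'b) set \<Rightarrow> 'a metric \<Rightarrow> 'b metric \<Rightarrow> real \<Rightarrow> bool" where
  "distortion_le R X Y D \<longleftrightarrow>
     (\<forall>(x, y)\<in>R. \<forall>(x', y')\<in>R. \<bar>mdist X x x' - mdist Y y y'\<bar> \<le> D)"

lemma distortion_leD:
  assumes "distortion_le R X Y D" "(x, y) \<in> R" "(x', y') \<in> R"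
  shows "mdist X x x' \<le> D + mdist Y y y'" "mdist Y y y' \<le> D + mdist X x x'"
  using assms unfolding distortion_le_def by fastforce+

text \<open>In a realization at Hausdorff distance less than \<open>r\<close>, the pairs of points less than \<open>r\<close>
  apart form a correspondence; distances within a pair change a distance by at most \<open>2 * r\<close>.\<close>

lemma correspondence_if_gh_dist_less:
  fixes X :: "'a metric" and Y :: "'b metric"
  assumes "gh_dist X Y < ennreal r"
  obtains R where "correspondence R X Y" "distortion_le R X Y (2 * r)"
proof -
  from assms obtain Z :: "('a + 'b) metric" and A B where
    AB: "A \<subseteq> mspace Z" "B \<subseteq> mspace Z"
    and iso: "isometric (submetric Z A) X" "isometric (submetric Z B) Y"
    and less: "hausdorff_dist Z A B < ennreal r"
    unfolding gh_dist_def Inf_less_iff by blast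
  from iso(1) AB(1) obtain g where g: "bij_betw g A (mspace X)"
    "\<And>z z'. z \<in> A \<Longrightarrow> z' \<in> A \<Longrightarrow> mdist X (g z) (g z') = mdist Z z z'"
    unfolding isometric_def by (auto simp: Int_absorb2)
  from iso(2) AB(2) obtain h where h: "bij_betw h B (mspace Y)"
    "\<And>z z'. z \<in> B \<Longrightarrow> z' \<in> B \<Longrightarrow> mdist Y (h z) (h z') = mdist Z z z'"
    unfolding isometric_def by (auto simp: Int_absorb2)
  have near_A: "\<exists>w\<in>B. mdist Z z w < r" if "z \<in> A" for z
  proof -
    have "(INF w\<in>B. ennreal (mdist Z z w)) < ennreal r"
      using less that unfolding hausdorff_dist_def by (auto dest: SUP_lessD)
    then show ?thesis
      unfolding INF_less_iff by (auto simp: ennreal_less_iff)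
  qed
  have near_B: "\<exists>z\<in>A. mdist Z z w < r" if "w \<in> B" for w
  proof -
    have "(INF z\<in>A. ennreal (mdist Z z w)) < ennreal r"
      using less that unfolding hausdorff_dist_def by (auto dest: SUP_lessD)
    then show ?thesis
      unfolding INF_less_iff by (auto simp: ennreal_less_iff)
  qed
  define P where "P = {(z, w). z \<in> A \<and> w \<in> B \<and> mdist Z z w < r}"
  define R where "R = map_prod g h ` P"
  show thesis
  proof
    have "fst ` P = A"
    proof (intro equalityI subsetI)
      fix z assume z: "z \<in> A"
      then obtain w where "w \<in> B" "mdist Z z w < r" using near_A by blast
      with z show "z \<in> fst ` P" by (intro image_eqI[of _ _ "(z, w)"]) (auto simp: P_def)
    qed (auto simp: P_def)
    moreover have "snd ` P = B"
    proof (intro equalityI subsetI)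
      fix w assume w: "w \<in> B"
      then obtain z where "z \<in> A" "mdist Z z w < r" using near_B by blast
      with w show "w \<in> snd ` P" by (intro image_eqI[of _ _ "(z, w)"]) (auto simp: P_def)
    qed (auto simp: P_def)
    moreover have "fst ` R = g ` fst ` P" "snd ` R = h ` snd ` P"
      by (simp_all add: R_def image_image)
    ultimately have "fst ` R = g ` A" "snd ` R = h ` B" by simp_all
    then show "correspondence R X Y"
      using g(1) h(1) unfolding correspondence_def bij_betw_def by simp
    have "\<bar>mdist Z z z' - mdist Z w w'\<bar> \<le> 2 * r"
      if "z \<in> A" "z' \<in> A" "w \<in> B" "w' \<in> B" "mdist Z z w < r" "mdist Z z' w' < r" for z z' w w'
    proof -
      have in_Z: "z \<in> mspace Z" "z' \<in> mspace Z" "w \<in> mspace Z" "w' \<in> mspace Z"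
        using that AB by auto
      have "mdist Z z z' \<le> mdist Z z w + (mdist Z w w' + mdist Z w' z')"
        using mdist_triangle[of z Z w z'] mdist_triangle[of w Z w' z'] in_Z by linarith
      moreover have "mdist Z w w' \<le> mdist Z w z + (mdist Z z z' + mdist Z z' w')"
        using mdist_triangle[of w Z z w'] mdist_triangle[of z Z z' w'] in_Z by linarith
      ultimately show ?thesis
        using that mdist_commute[of Z w z] mdist_commute[of Z w' z'] by linarith
    qed
    then show "distortion_le R X Y (2 * r)"
      unfolding distortion_le_def R_def P_def by (auto simp: g(2) h(2))
  qed
qed

text \<open>Conversely, a correspondence of distortion \<open>2 * r\<close> gives the metric on the disjoint union
  obtained by joining the two points of every pair in \<open>R\<close> by a segment of length \<open>r\<close>.
  Here \<open>r > 0\<close> keeps paired points apart.\<close>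

definition bridge :: "'a metric \<Rightarrow> 'b metric \<Rightarrow> ('a \<times> 'b) set \<Rightarrow> real \<Rightarrow> 'a \<Rightarrow> 'b \<Rightarrow> real" where
  "bridge X Y R r x y = (INF (u, v)\<in>R. mdist X x u + r + mdist Y v y)"

fun glue :: "'a metric \<Rightarrow> 'b metric \<Rightarrow> ('a \<times> 'b) set \<Rightarrow> real \<Rightarrow> 'a + 'b \<Rightarrow> 'a + 'b \<Rightarrow> real" where
  "glue X Y R r (Inl x) (Inl x') = mdist X x x'"
| "glue X Y R r (Inr y) (Inr y') = mdist Y y y'"
| "glue X Y R r (Inl x) (Inr y) = bridge X Y R r x y"
| "glue X Y R r (Inr y) (Inl x) = bridge X Y R r x y"

context
  fixes X :: "'a metric" and Y :: "'b metric" and R :: "('a \<times> 'b) set" and r :: real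
  assumes corr: "correspondence R X Y" and dist: "distortion_le R X Y (2 * r)"
    and r: "0 < r" and nonempty: "mspace X \<noteq> {}"
begin

lemma in_spaces: "(x, y) \<in> R \<Longrightarrow> x \<in> mspace X \<and> y \<in> mspace Y"
  using corr unfolding correspondence_def by force

lemma bridge_le: "(u, v) \<in> R \<Longrightarrow> bridge X Y R r x y \<le> mdist X x u + r + mdist Y v y"
  unfolding bridge_def
  by (rule cINF_lower2[where x = "(u, v)"])
    (use r in \<open>auto intro!: bdd_belowI[where m = 0] add_nonneg_nonneg\<close>)

lemma le_bridge:
  assumes "\<And>u v. (u, v) \<in> R \<Longrightarrow> q \<le> mdist X x u + r + mdist Y v y"
  shows "q \<le> bridge X Y R r x y"
proof -
  have "R \<noteq> {}"
    using corr nonempty unfolding correspondence_def by auto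
  then show ?thesis
    unfolding bridge_def using assms by (intro cINF_greatest) auto
qed

lemma bridge_ge: "r \<le> bridge X Y R r x y"
  by (rule le_bridge) simp

lemma bridge_triangle_left:
  assumes "x \<in> mspace X" "x' \<in> mspace X"
  shows "bridge X Y R r x y \<le> mdist X x x' + bridge X Y R r x' y"
proof -
  have "bridge X Y R r x y - mdist X x x' \<le> bridge X Y R r x' y"
  proof (rule le_bridge)
    fix u v assume "(u, v) \<in> R"
    then show "bridge X Y R r x y - mdist X x x' \<le> mdist X x' u + r + mdist Y v y"
      using bridge_le[of u v x y] mdist_triangle[of x X x' u] in_spaces assms by fastforce
  qed
  then show ?thesis by simp
qed

lemma bridge_triangle_right:
  assumes "y \<in> mspace Y" "y' \<in> mspace Y"
  shows "bridge X Y R r x y \<le> bridge X Y R r x y' + mdist Y y' y"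
proof -
  have "bridge X Y R r x y - mdist Y y' y \<le> bridge X Y R r x y'"
  proof (rule le_bridge)
    fix u v assume "(u, v) \<in> R"
    then show "bridge X Y R r x y - mdist Y y' y \<le> mdist X x u + r + mdist Y v y'"
      using bridge_le[of u v x y] mdist_triangle[of v Y y' y] in_spaces assms by fastforce
  qed
  then show ?thesis by simp
qed

text \<open>A path across two bridges has two segments of total length \<open>2 * r\<close>, which pay for
  the distortion of \<open>R\<close>.\<close>

lemma mdist_le_bridges_left:
  assumes "x \<in> mspace X" "x' \<in> mspace X" "y \<in> mspace Y"
  shows "mdist X x x' \<le> bridge X Y R r x y + bridge X Y R r x' y"
proof -
  have "mdist X x x' - bridge X Y R r x' y \<le> bridge X Y R r x y"
  proof (rule le_bridge)
    fix u v assume uv: "(u, v) \<in> R"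
    have "mdist X x x' - (mdist X x u + r + mdist Y v y) \<le> bridge X Y R r x' y"
    proof (rule le_bridge)
      fix u' v' assume uv': "(u', v') \<in> R"
      note pts = in_spaces[OF uv] in_spaces[OF uv']
      have "mdist X x x' \<le> mdist X x u + (mdist X u u' + mdist X u' x')"
        using mdist_triangle[of x X u x'] mdist_triangle[of u X u' x'] pts assms by linarith
      moreover have "mdist Y v v' \<le> mdist Y v y + mdist Y v' y"
        using mdist_triangle[of v Y y v'] mdist_commute[of Y y v'] pts assms by linarith
      moreover have "mdist X u u' \<le> 2 * r + mdist Y v v'"
        using distortion_leD[OF dist uv uv'] by simp
      ultimately show "mdist X x x' - (mdist X x u + r + mdist Y v y) \<le>
          mdist X x' u' + r + mdist Y v' y"
        using mdist_commute[of X u' x'] by linarith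
    qed
    then show "mdist X x x' - bridge X Y R r x' y \<le> mdist X x u + r + mdist Y v y"
      by simp
  qed
  then show ?thesis by simp
qed

lemma mdist_le_bridges_right:
  assumes "y \<in> mspace Y" "y' \<in> mspace Y" "x \<in> mspace X"
  shows "mdist Y y y' \<le> bridge X Y R r x y + bridge X Y R r x y'"
proof -
  have "mdist Y y y' - bridge X Y R r x y' \<le> bridge X Y R r x y"
  proof (rule le_bridge)
    fix u v assume uv: "(u, v) \<in> R"
    have "mdist Y y y' - (mdist X x u + r + mdist Y v y) \<le> bridge X Y R r x y'"
    proof (rule le_bridge)
      fix u' v' assume uv': "(u', v') \<in> R"
      note pts = in_spaces[OF uv] in_spaces[OF uv']
      have "mdist Y y y' \<le> mdist Y y v + (mdist Y v v' + mdist Y v' y')"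
        using mdist_triangle[of y Y v y'] mdist_triangle[of v Y v' y'] pts assms by linarith
      moreover have "mdist X u u' \<le> mdist X x u + mdist X x u'"
        using mdist_triangle[of u X x u'] mdist_commute[of X x u] pts assms by linarith
      moreover have "mdist Y v v' \<le> 2 * r + mdist X u u'"
        using distortion_leD[OF dist uv uv'] by simp
      ultimately show "mdist Y y y' - (mdist X x u + r + mdist Y v y) \<le>
          mdist X x u' + r + mdist Y v' y'"
        using mdist_commute[of Y y v] by linarith
    qed
    then show "mdist Y y y' - bridge X Y R r x y' \<le> mdist X x u + r + mdist Y v y"
      by simp
  qed
  then show ?thesis by simp
qed

lemma Metric_space_glue: "Metric_space (mspace X <+> mspace Y) (glue X Y R r)"
proof
  show "0 \<le> glue X Y R r p q" for p q
  proof -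
    have "0 \<le> bridge X Y R r x y" for x y
      using r bridge_ge[of x y] by linarith
    then show ?thesis
      by (cases "(X, Y, R, r, p, q)" rule: glue.cases) auto
  qed
  show "glue X Y R r p q = glue X Y R r q p" for p q
    by (cases "(X, Y, R, r, p, q)" rule: glue.cases) (auto simp: mdist_commute)
  show "glue X Y R r p q = 0 \<longleftrightarrow> p = q"
    if "p \<in> mspace X <+> mspace Y" "q \<in> mspace X <+> mspace Y" for p q
  proof -
    have "bridge X Y R r x y \<noteq> 0" for x y
      using r bridge_ge[of x y] by linarith
    then show ?thesis
      using that by auto
  qed
  show "glue X Y R r p q \<le> glue X Y R r p s + glue X Y R r s q"
    if "p \<in> mspace X <+> mspace Y" "s \<in> mspace X <+> mspace Y" "q \<in> mspace X <+> mspace Y" for p s q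
  proof -
    have reversed: "bridge X Y R r x' y \<le> bridge X Y R r x y + mdist X x x'"
      if "x \<in> mspace X" "x' \<in> mspace X" for x x' y
      using bridge_triangle_left[of x' x y] that by (simp add: mdist_commute add.commute)
    have reversed': "bridge X Y R r x y \<le> mdist Y y y' + bridge X Y R r x y'"
      if "y \<in> mspace Y" "y' \<in> mspace Y" for x y y'
      using bridge_triangle_right[of y y' x] that by (simp add: mdist_commute add.commute)
    show ?thesis
      by (rule PlusE[OF that(1)]; rule PlusE[OF that(2)]; rule PlusE[OF that(3)])
        (simp_all add: mdist_triangle bridge_triangle_left bridge_triangle_right
          mdist_le_bridges_left mdist_le_bridges_right reversed reversed')
  qed
qed

lemma gh_dist_le_correspondence: "gh_dist X Y \<le> ennreal r"
proof -
  interpret glue: Metric_space "mspace X <+> mspace Y" "glue X Y R r"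
    by (rule Metric_space_glue)
  define Z where "Z = metric (mspace X <+> mspace Y, glue X Y R r)"
  have Z: "mspace Z = mspace X <+> mspace Y" "mdist Z = glue X Y R r"
    unfolding Z_def by simp_all
  let ?A = "Inl ` mspace X :: ('a + 'b) set" and ?B = "Inr ` mspace Y :: ('a + 'b) set"
  have sub: "?A \<subseteq> mspace Z" "?B \<subseteq> mspace Z"
    unfolding Z by auto
  have iso_X: "isometric (submetric Z ?A) X"
    unfolding isometric_def using sub
    by (intro exI[where x = projl]) (auto simp: Z Int_absorb2 intro!: bij_betwI[where g = Inl])
  have iso_Y: "isometric (submetric Z ?B) Y"
    unfolding isometric_def using sub
    by (intro exI[where x = projr]) (auto simp: Z Int_absorb2 intro!: bij_betwI[where g = Inr])
  have pair: "bridge X Y R r x y \<le> r" if "(x, y) \<in> R" for x y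
    using bridge_le[OF that, of x y] in_spaces[OF that] by (simp add: mdist_zero[THEN iffD2])
  have "hausdorff_dist Z ?A ?B \<le> ennreal r"
    unfolding hausdorff_dist_def
  proof (rule max.boundedI; rule SUP_least)
    fix p assume "p \<in> ?A"
    then obtain x y where "p = Inl x" "(x, y) \<in> R"
      using corr unfolding correspondence_def by force
    then show "(INF q\<in>?B. ennreal (mdist Z p q)) \<le> ennreal r"
      using in_spaces pair by (intro INF_lower2[where i = "Inr y"]) (auto simp: Z ennreal_leI)
  next
    fix q assume "q \<in> ?B"
    then obtain x y where "q = Inr y" "(x, y) \<in> R"
      using corr unfolding correspondence_def by force
    then show "(INF p\<in>?A. ennreal (mdist Z p q)) \<le> ennreal r"
      using in_spaces pair by (intro INF_lower2[where i = "Inl x"]) (auto simp: Z ennreal_leI)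
  qed
  moreover have "gh_dist X Y \<le> hausdorff_dist Z ?A ?B"
    unfolding gh_dist_def using sub iso_X iso_Y by (intro Inf_lower) blast
  ultimately show ?thesis by (rule order_trans[rotated])
qed

end

lemma gh_dist_eq_half_min_distortion:
  assumes "0 < D" "mspace X \<noteq> {}" "correspondence R X Y" "distortion_le R X Y D"
    and least: "\<And>R' D'. correspondence R' X Y \<Longrightarrow> distortion_le R' X Y D' \<Longrightarrow> D \<le> D'"
  shows "gh_dist X Y = ennreal (D / 2)"
proof (rule antisym)
  show "gh_dist X Y \<le> ennreal (D / 2)"
    using gh_dist_le_correspondence[of R X Y "D / 2"] assms by simp
  show "ennreal (D / 2) \<le> gh_dist X Y"
  proof (rule ccontr)
    assume "\<not> ennreal (D / 2) \<le> gh_dist X Y"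
    then obtain s where s: "gh_dist X Y < s" "s < ennreal (D / 2)"
      using dense by (auto simp: not_le)
    then obtain r where "s = ennreal r" "0 \<le> r"
      by (cases s) auto
    then have "gh_dist X Y < ennreal r" "2 * r < D"
      using s by (auto simp: ennreal_less_iff)
    then show False
      using least by (meson correspondence_if_gh_dist_less not_le)
  qed
qed

section \<open>Four-point spaces\<close>

text \<open>The minimal distortion: \<open>e - t\<close> comes from the longest edge, which joins different blocks for
  \<open>m > 1\<close>. For \<open>m = 2, 3\<close> the other two entries are the diameter of the largest block and the
  defect of the shortest edge between blocks; for larger \<open>m\<close> all blocks are points.\<close>

definition four_point_distortion ::
    "real \<Rightarrow> real \<Rightarrow> real \<Rightarrow> real \<Rightarrow> real \<Rightarrow> real \<Rightarrow> nat \<Rightarrow> real" where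
  "four_point_distortion a b c d e t m =
     (if m = 1 then e
      else if m = 2 then max (e - t) (max c (t - d))
      else if m = 3 then max (e - t) (max a (t - b))
      else if m = 4 then max (e - t) (t - a)
      else max (e - t) t)"

text \<open>The matrices \<open>S1\<close> and \<open>S2\<close> differ in which of the edges \<open>p\<close> and \<open>q\<close> is \<open>d\<close>. Fixing only their
  minimum treats both at once and leaves the larger of the two free.\<close>

locale four_points =
  fixes Y :: "'a metric" and y1 y2 y3 y4 :: 'a and a b c d e p q :: real
  assumes space: "mspace Y = {y1, y2, y3, y4}"
    and dists: "mdist Y y1 y2 = a" "mdist Y y1 y3 = b" "mdist Y y2 y3 = c"
      "mdist Y y1 y4 = p" "mdist Y y2 y4 = e" "mdist Y y3 y4 = q"
    and order: "0 < a" "a < b" "b < c" "c < d" "d < e"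
    and fourth: "min p q = d" "p \<le> e" "q \<le> e"
begin

lemma dists_sym:
  "mdist Y y2 y1 = a" "mdist Y y3 y1 = b" "mdist Y y3 y2 = c"
  "mdist Y y4 y1 = p" "mdist Y y4 y2 = e" "mdist Y y4 y3 = q"
  using dists mdist_commute by metis+

lemma dists_refl:
  "mdist Y y1 y1 = 0" "mdist Y y2 y2 = 0" "mdist Y y3 y3 = 0" "mdist Y y4 y4 = 0"
  using space by (simp_all)

lemmas all_dists = dists dists_sym dists_refl

lemma bounds: "d \<le> p" "d \<le> q" "p = d \<or> q = d"
  using fourth(1) by (auto simp: min_def split: if_splits)

text \<open>For \<open>m < 4\<close> each point is related to the block containing it, the blocks being
  those of single linkage: merging the closest points first makes blocks small and far apart.\<close>

lemma optimal_correspondence: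
  assumes "0 < t" "1 \<le> m"
  shows "\<exists>R. correspondence R (simplex_metric t m) Y \<and>
    distortion_le R (simplex_metric t m) Y (four_point_distortion a b c d e t m)"
proof -
  note simps = correspondence_def distortion_le_def simplex_metric[OF assms(1)] space all_dists
    four_point_distortion_def
  note ineqs = order fourth bounds assms
  consider "m = 1" | "m = 2" | "m = 3" | "m \<ge> 4"
    using assms(2) by linarith
  then show ?thesis
  proof cases
    case 1
    then show ?thesis
      using ineqs by (intro exI[where x = "{(1, y1), (1, y2), (1, y3), (1, y4)}"])
        (auto simp: simps)
  next
    case 2
    then have "{1..m} = {1, 2}" by auto
    then show ?thesis
      using ineqs 2 by (intro exI[where x = "{(1, y1), (1, y2), (1, y3), (2, y4)}"])
        (auto simp: simps)
  next
    case 3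
    then have "{1..m} = {1, 2, 3}" by auto
    then show ?thesis
      using ineqs 3 by (intro exI[where x = "{(1, y1), (1, y2), (2, y3), (3, y4)}"])
        (auto simp: simps)
  next
    case 4
    \<comment> \<open>For \<open>m = 4\<close> this is a bijection; otherwise \<open>y4\<close> has several partners, whose distance \<open>t\<close>
      dominates the defects \<open>t - mdist Y y y'\<close>.\<close>
    let ?g = "\<lambda>i::nat. if i = 1 then y1 else if i = 2 then y2 else if i = 3 then y3 else y4"
    let ?R = "(\<lambda>i. (i, ?g i)) ` {1..m}"
    have "snd ` ?R = {y1, y2, y3, y4}"
    proof -
      have "{1, 2, 3, 4} \<subseteq> {1..m}" using 4 by auto
      then have "?g ` {1, 2, 3, 4} \<subseteq> ?g ` {1..m}" by (rule image_mono)
      then show ?thesis by (auto simp: image_image)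
    qed
    then have "correspondence ?R (simplex_metric t m) Y"
      by (simp add: simps image_image)
    moreover have "\<bar>(if i = j then 0 else t) - mdist Y (?g i) (?g j)\<bar>
        \<le> four_point_distortion a b c d e t m" if "i \<in> {1..m}" "j \<in> {1..m}" for i j
    proof (cases "m = 4")
      case True
      then have "i \<in> {1, 2, 3, 4}" "j \<in> {1, 2, 3, 4}" using that by auto
      then show ?thesis
        using ineqs True by (auto simp: simps)
    next
      case False
      then show ?thesis
        using ineqs 4 by (auto simp: simps)
    qed
    then have "distortion_le ?R (simplex_metric t m) Y (four_point_distortion a b c d e t m)"
      unfolding distortion_le_def by (auto simp: simplex_metric[OF assms(1)])
    ultimately show ?thesis by blast
  qed
qed

text \<open>Small distortion forces two kinds of behaviour: points of \<open>Y\<close> further apart than the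
  distortion have no common partner, and points so close that their distance falls short of \<open>t\<close> by
  more than the distortion have a single partner in common. If the distortion were below the claimed
  bound, these constraints would give the four points too many or too few partners: there are
  at most \<open>m\<close>, and exactly \<open>m\<close> when the distortion is less than \<open>t\<close>.\<close>

lemma distortion_lower_bound:
  assumes t: "0 < t" and m: "1 \<le> m"
    and corr: "correspondence R (simplex_metric t m) Y"
    and dist: "distortion_le R (simplex_metric t m) Y D"
  shows "four_point_distortion a b c d e t m \<le> D"
proof -
  have fst_R: "fst ` R = {1..m}" and snd_R: "snd ` R = {y1, y2, y3, y4}"
    using corr by (simp_all add: correspondence_def simplex_metric[OF t] space)
  have "y1 \<in> snd ` R" "y2 \<in> snd ` R" "y3 \<in> snd ` R" "y4 \<in> snd ` R"
    by (simp_all add: snd_R)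
  then obtain x1 x2 x3 x4 where
    R: "(x1, y1) \<in> R" "(x2, y2) \<in> R" "(x3, y3) \<in> R" "(x4, y4) \<in> R"
    by auto
  have x_in: "x1 \<in> {1..m}" "x2 \<in> {1..m}" "x3 \<in> {1..m}" "x4 \<in> {1..m}"
    using R fst_R by force+
  have shared: "mdist Y y y' \<le> D" if "(x, y) \<in> R" "(x, y') \<in> R" for x y y'
    using distortion_leD[OF dist that] by (simp add: simplex_metric[OF t])
  have split: "t - mdist Y y y' \<le> D \<and> mdist Y y y' - t \<le> D"
    if "(x, y) \<in> R" "(x', y') \<in> R" "x \<noteq> x'" for x x' y y'
    using distortion_leD[OF dist that(1,2)] that(3) by (simp add: simplex_metric[OF t])
  have separate: "x \<noteq> x'" if "(x, y) \<in> R" "(x', y') \<in> R" "D < mdist Y y y'" for x x' y y'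
    using shared[of x y y'] that by auto
  have together: "x = x'" if "(x, y) \<in> R" "(x', y') \<in> R" "D < t - mdist Y y y'" for x x' y y'
    using split[of x y x' y'] that by auto
  note ineqs = order fourth bounds t
  have diam: "e - t \<le> D"
    using shared[of x2 y2 y4] split[OF R(2) R(4)] R t by (cases "x2 = x4") (auto simp: all_dists)
  \<comment> \<open>A point of \<open>Y\<close> with two partners would force \<open>t \<le> D\<close>, by \<open>together\<close> with \<open>y = y'\<close>.\<close>
  have number_of_partners: "m = card {x1, x2, x3, x4}" if D: "D < t"
  proof -
    have "x \<in> {x1, x2, x3, x4}" if x: "x \<in> {1..m}" for x
    proof (rule ccontr)
      assume not: "x \<notin> {x1, x2, x3, x4}"
      from x obtain y where y: "(x, y) \<in> R"
        unfolding fst_R[symmetric] by auto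
      then have "y \<in> {y1, y2, y3, y4}"
        unfolding snd_R[symmetric] by force
      then show False
        using D together[OF y R(1)] together[OF y R(2)] together[OF y R(3)] together[OF y R(4)] not
        by (auto simp: all_dists)
    qed
    then have "{1..m} = {x1, x2, x3, x4}"
      using x_in by blast
    then have "card {1..m} = card {x1, x2, x3, x4}"
      by (rule arg_cong)
    then show ?thesis by simp
  qed
  consider "m = 1" | "m = 2" | "m = 3" | "m = 4" | "m \<ge> 5"
    using m by linarith
  then show ?thesis
  proof cases
    case 1
    then have "x2 = x4" using x_in by auto
    then show ?thesis using shared[of x2 y2 y4] R 1 by (simp add: all_dists four_point_distortion_def)
  next
    case 2
    have "c \<le> D"
    proof (rule ccontr)
      assume "\<not> c \<le> D"
      then have "x1 \<noteq> x4" "x2 \<noteq> x4" "x3 \<noteq> x4" "x2 \<noteq> x3"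
        using ineqs separate[OF R(1) R(4)] separate[OF R(2) R(4)] separate[OF R(3) R(4)]
          separate[OF R(2) R(3)] by (simp_all add: all_dists)
      moreover have "{x1, x2, x3, x4} \<subseteq> {1, 2}"
        using x_in 2 by auto
      ultimately show False by auto
    qed
    moreover have "t - d \<le> D"
    proof (rule ccontr)
      assume *: "\<not> t - d \<le> D"
      then have "x1 = x2" "x1 = x3"
        using ineqs together[OF R(1) R(2)] together[OF R(1) R(3)] by (simp_all add: all_dists)
      moreover have "x1 = x4 \<or> x3 = x4"
        using * bounds(3) together[OF R(1) R(4)] together[OF R(3) R(4)] by (auto simp: all_dists)
      ultimately have "card {x1, x2, x3, x4} = 1"
        by auto
      moreover have "m = card {x1, x2, x3, x4}"
        using * ineqs by (intro number_of_partners) linarith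
      ultimately show False using 2 by simp
    qed
    ultimately show ?thesis using diam 2 by (simp add: four_point_distortion_def)
  next
    case 3
    have "a \<le> D"
    proof (rule ccontr)
      assume "\<not> a \<le> D"
      then have "card {x1, x2, x3, x4} = 4"
        using ineqs separate[OF R(1) R(2)] separate[OF R(1) R(3)] separate[OF R(2) R(3)]
          separate[OF R(1) R(4)] separate[OF R(2) R(4)] separate[OF R(3) R(4)]
        by (simp add: all_dists)
      moreover have "card {x1, x2, x3, x4} \<le> card {1..m}"
        using x_in by (intro card_mono) auto
      ultimately show False using 3 by simp
    qed
    moreover have "t - b \<le> D"
    proof (rule ccontr)
      assume *: "\<not> t - b \<le> D"
      then have "x1 = x2 \<and> x1 = x3"
        using ineqs together[OF R(1) R(2)] together[OF R(1) R(3)] by (simp add: all_dists)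
      then have "card {x1, x2, x3, x4} \<le> 2"
        by (auto simp: card_insert_if)
      moreover have "m = card {x1, x2, x3, x4}"
        using * ineqs by (intro number_of_partners) linarith
      ultimately show False using 3 by simp
    qed
    ultimately show ?thesis using diam 3 by (simp add: four_point_distortion_def)
  next
    case 4
    have "t - a \<le> D"
    proof (rule ccontr)
      assume *: "\<not> t - a \<le> D"
      then have "x1 = x2"
        using together[OF R(1) R(2)] by (simp add: all_dists)
      then have "card {x1, x2, x3, x4} \<le> 3"
        by (simp add: card_insert_if)
      moreover have "m = card {x1, x2, x3, x4}"
        using * ineqs by (intro number_of_partners) linarith
      ultimately show False using 4 by simp
    qed
    then show ?thesis using diam 4 by (simp add: four_point_distortion_def)
  next
    case 5
    have "card {x1, x2, x3, x4} \<le> 4"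
      by (simp add: card_insert_if)
    then have "t \<le> D"
      using number_of_partners 5 by fastforce
    then show ?thesis
      using diam 5 by (simp add: four_point_distortion_def)
  qed
qed

lemma gh_dist_simplex_four_points:
  assumes "0 < t" "1 \<le> m"
  shows "gh_dist (simplex_metric t m) Y = ennreal (four_point_distortion a b c d e t m / 2)"
proof -
  obtain R where R: "correspondence R (simplex_metric t m) Y"
    "distortion_le R (simplex_metric t m) Y (four_point_distortion a b c d e t m)"
    using optimal_correspondence[OF assms] by blast
  have "0 < four_point_distortion a b c d e t m"
    using order assms unfolding four_point_distortion_def by (auto simp: less_max_iff_disj)
  moreover have "mspace (simplex_metric t m) \<noteq> {}"
    using assms by (simp add: simplex_metric)
  ultimately show ?thesis
    using R distortion_lower_bound[OF assms] by (rule gh_dist_eq_half_min_distortion)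
qed

end

section \<open>The two matrices and a continuum of spaces\<close>

lemma four_points_S1:
  assumes "0 < a" "a < b" "b < c" "c < d" "d < f" "f < e" "triangle_inequalities (S1 a b c d e f)"
  shows "four_points (matrix_metric (S1 a b c d e f)) 1 2 3 4 a b c d e d f"
  using assms unfolding four_points_def S1_matrix_metric[OF assms]
  by (simp add: S1_def vector_4 UNIV_4)

lemma four_points_S2:
  assumes "0 < a" "a < b" "b < c" "c < d" "d < f" "f < e" "triangle_inequalities (S2 a b c d e f)"
  shows "four_points (matrix_metric (S2 a b c d e f)) 1 2 3 4 a b c d e f d"
  using assms unfolding four_points_def S2_matrix_metric[OF assms]
  by (simp add: S2_def vector_4 UNIV_4)

text \<open>The instance \<open>a, b, c, d, e = 10, \<dots>, 14\<close> of the first matrix. With all edges between \<open>10\<close> and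
  \<open>20\<close> the triangle inequalities hold automatically. The last case is meant for the edge \<open>{3, 4}\<close>;
  a default value in the same range makes the bounds hold for all arguments.\<close>

definition edge_length :: "real \<Rightarrow> nat set \<Rightarrow> real" where
  "edge_length f E =
     (if E = {1, 2} then 10 else if E = {1, 3} then 11 else if E = {2, 3} then 12
      else if E = {1, 4} then 13 else if E = {2, 4} then 14 else f)"

definition family_dist :: "real \<Rightarrow> nat \<Rightarrow> nat \<Rightarrow> real" where
  "family_dist f i j = (if i = j then 0 else edge_length f {i, j})"

definition family_space :: "real \<Rightarrow> nat metric" where
  "family_space f = metric ({1, 2, 3, 4}, family_dist f)"

lemma family_space:
  assumes "13 < f" "f < 14"
  shows "mspace (family_space f) = {1, 2, 3, 4}" "mdist (family_space f) = family_dist f"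
proof -
  have bounds: "10 \<le> edge_length f E" "edge_length f E \<le> 20" for E
    using assms by (auto simp: edge_length_def)
  interpret Metric_space "{1, 2, 3, 4}" "family_dist f"
  proof
    fix i j k :: nat
    show "0 \<le> family_dist f i j"
      using bounds(1)[of "{i, j}"] by (simp add: family_dist_def)
    show "family_dist f i j = family_dist f j i"
      by (simp add: family_dist_def insert_commute)
    show "family_dist f i j = 0 \<longleftrightarrow> i = j"
      using bounds(1)[of "{i, j}"] by (simp add: family_dist_def)
    show "family_dist f i k \<le> family_dist f i j + family_dist f j k"
      using bounds(1)[of "{i, j}"] bounds(1)[of "{j, k}"] bounds[of "{i, k}"]
      by (auto simp: family_dist_def)
  qed
  show "mspace (family_space f) = {1, 2, 3, 4}" "mdist (family_space f) = family_dist f"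
    unfolding family_space_def by (rule mspace_metric, rule mdist_metric)
qed

lemma four_points_family_space:
  assumes "13 < f" "f < 14"
  shows "four_points (family_space f) 1 2 3 4 10 11 12 13 14 13 f"
  using assms unfolding four_points_def family_space[OF assms]
  by (simp add: family_dist_def edge_length_def doubleton_eq_iff)

text \<open>The edge \<open>f\<close> is the only distance strictly between \<open>13\<close> and \<open>14\<close>.\<close>

lemma eq_if_isometric_family_space:
  assumes "13 < f" "f < 14" "13 < f'" "f' < 14" "isometric (family_space f) (family_space f')"
  shows "f = f'"
proof -
  obtain h where h: "bij_betw h {1, 2, 3, 4} {1, 2, 3, 4::nat}"
    "\<And>i j. i \<in> {1, 2, 3, 4} \<Longrightarrow> j \<in> {1, 2, 3, 4} \<Longrightarrow> family_dist f' (h i) (h j) = family_dist f i j"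
    using assms unfolding isometric_def by (auto simp: family_space)
  have "family_dist f' (h 3) (h 4) = f"
    using h(2)[of 3 4] by (simp add: family_dist_def edge_length_def doubleton_eq_iff)
  moreover have "family_dist f' i j \<in> {0, 10, 11, 12, 13, 14, f'}" for i j
    by (simp add: family_dist_def edge_length_def)
  ultimately have "f \<in> {0, 10, 11, 12, 13, 14, f'}"
    by metis
  then show ?thesis
    using assms by auto
qed

lemma isometric_refl: "isometric X X"
  unfolding isometric_def by (rule exI[where x = id]) auto

theorem mainTheorem10:
  shows "(\<forall>a b c d e f f' :: real.
            0 < a \<and> a < b \<and> b < c \<and> c < d \<and> d < f \<and> f < e \<and> d < f' \<and> f' < e \<and>
            triangle_inequalities (S1 a b c d e f) \<and> triangle_inequalities (S2 a b c d e f) \<and>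
            triangle_inequalities (S1 a b c d e f') \<and> triangle_inequalities (S2 a b c d e f') \<longrightarrow>
            (\<forall>t>0. \<forall>m\<ge>1.
               gh_dist (simplex_metric t m) (matrix_metric (S1 a b c d e f)) =
               gh_dist (simplex_metric t m) (matrix_metric (S1 a b c d e f')) \<and>
               gh_dist (simplex_metric t m) (matrix_metric (S2 a b c d e f)) =
               gh_dist (simplex_metric t m) (matrix_metric (S2 a b c d e f')))) \<and>
         (\<exists>F :: nat metric set.
            F \<approx> (UNIV :: real set) \<and>
            (\<forall>Y\<in>F. finite (mspace Y) \<and> mspace Y \<noteq> {}) \<and>
            (\<forall>Y\<in>F. \<forall>Y'\<in>F. Y \<noteq> Y' \<longrightarrow> \<not> isometric Y Y') \<and>
            (\<forall>Y\<in>F. \<forall>Y'\<in>F. \<forall>t>0. \<forall>m\<ge>1.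
               gh_dist (simplex_metric t m) Y = gh_dist (simplex_metric t m) Y'))"
proof ((intro conjI allI impI; (elim conjE)?), goal_cases)
  case (1 a b c d e f f' t m)
  then show ?case
    using four_points.gh_dist_simplex_four_points[OF four_points_S1] by simp
next
  case (2 a b c d e f f' t m)
  then show ?case
    using four_points.gh_dist_simplex_four_points[OF four_points_S2] by simp
next
  case 3
  let ?F = "family_space ` {13<..<14}"
  have inj: "inj_on family_space {13<..<14}"
  proof (rule inj_onI)
    fix f f' assume "f \<in> {13<..<14}" "f' \<in> {13<..<14}" "family_space f = family_space f'"
    then show "f = f'"
      using eq_if_isometric_family_space[of f f'] by (simp add: isometric_refl)
  qed
  have "?F \<approx> {13<..<14::real}"
    using inj by (rule inj_on_image_eqpoll_self)
  also have "{13<..<14::real} \<approx> (UNIV :: real set)"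
    by (rule open_interval_eqpoll_reals[THEN iffD2]) simp
  finally have "?F \<approx> (UNIV :: real set)" .
  moreover have "finite (mspace Y) \<and> mspace Y \<noteq> {}" if "Y \<in> ?F" for Y
    using that by (auto simp: family_space)
  moreover have "\<not> isometric Y Y'" if "Y \<in> ?F" "Y' \<in> ?F" "Y \<noteq> Y'" for Y Y'
    using that eq_if_isometric_family_space by force
  moreover have "gh_dist (simplex_metric t m) Y = gh_dist (simplex_metric t m) Y'"
    if "Y \<in> ?F" "Y' \<in> ?F" "0 < t" "1 \<le> m" for Y Y' t m
    using that four_points.gh_dist_simplex_four_points[OF four_points_family_space] by auto
  ultimately show ?case
    by (intro exI[where x = ?F]) blast
qed

end
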